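(* For every integer $s\ge 0$, the Lucas polynomial $L_s^{*}(\Theta)$ is given by the Rodrigues formula $$L_{s}^{*}(\Theta)=2\,\frac{s!}{(2s)!}\left(\Theta^{2}+4\right)^{1/2}\frac{d^{s}}{d\Theta^{s}}\left\{\left(\Theta^{2}+4\right)^{s-1/2}\right\}.$$
   Context: The Lucas polynomials $L_s^{*}(\Theta)$, $s=0,1,2,\ldots$, are defined by $L_0^{*}(\Theta)=2$, $L_1^{*}(\Theta)=\Theta$ and $L_s^{*}(\Theta)=\Theta L_{s-1}^{*}(\Theta)+L_{s-2}^{*}(\Theta)$ for $s\ge 2$; explicitly, $L_s^{*}(\Theta)=2^{-s}\left[(\Theta-\sqrt{\Theta^2+4})^{s}+(\Theta+\sqrt{\Theta^2+4})^{s}\right]$. Here $\Theta$ is a real variable and half-integer powers of $\Theta^2+4>0$ are the positive real ones. *)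

theory Defs
  imports "HOL-Analysis.Analysis" "HOL-Computational_Algebra.Polynomial"
begin

fun lucas_poly :: "nat \<Rightarrow> real poly" where
  "lucas_poly 0 = [:2:]"
| "lucas_poly (Suc 0) = [:0, 1:]"
| "lucas_poly (Suc (Suc s)) = [:0, 1:] * lucas_poly (Suc s) + lucas_poly s"

end

theory Submission imports Defs begin

text \<open>
  Write \<open>w = t\<^sup>2 + 4\<close>, \<open>u\<^sub>s = w\<^sup>s\<^sup>-\<^sup>1\<^sup>/\<^sup>2\<close> and \<open>D\<close> for the derivative. Applying
  the Leibniz rule to \<open>D u\<^sub>s\<^sub>+\<^sub>1 = (2s+1) t u\<^sub>s\<close> and to \<open>u\<^sub>s\<^sub>+\<^sub>1 = w u\<^sub>s\<close> gives linear
  relations between \<open>D\<^sup>s u\<^sub>s\<close>, \<open>D\<^sup>s\<^sup>-\<^sup>1 u\<^sub>s\<close>, \<open>D\<^sup>s\<^sup>-\<^sup>2 u\<^sub>s\<close> and the corresponding derivatives of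
  \<open>u\<^sub>s\<^sub>+\<^sub>1\<close>. Eliminating all lower derivatives leaves a three-term recurrence for
  \<open>f\<^sub>s = D\<^sup>s u\<^sub>s\<close>, namely \<open>f\<^sub>s\<^sub>+\<^sub>2 = 2(2s+3) (t f\<^sub>s\<^sub>+\<^sub>1 + 2(2s+1) f\<^sub>s)\<close>, which the factor
  \<open>s!/(2s)!\<close> turns into the recurrence of the Lucas polynomials.
\<close>

text \<open>Reduces a closed form for all iterated derivatives to one differentiation step for a
  guessed family \<open>F\<close>.\<close>

lemma higher_deriv_eqI:
  fixes F :: "nat \<Rightarrow> 'a \<Rightarrow> 'a::real_normed_field"
  assumes "\<And>n x. (F n has_field_derivative F (Suc n) x) (at x)"
  shows "(deriv ^^ n) (F 0) = F n"
proof (induction n)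
  case (Suc n)
  then show ?case using DERIV_imp_deriv[OF assms] by auto
qed simp

lemma higher_deriv_mult_linear:
  fixes F :: "nat \<Rightarrow> real \<Rightarrow> real"
  assumes "\<And>n x. (F n has_field_derivative F (Suc n) x) (at x)"
  shows "(deriv ^^ n) (\<lambda>x. c * (x * F 0 x)) = (\<lambda>x. c * (x * F n x + real n * F (n - 1) x))"
proof -
  define G where "G n x = c * (x * F n x + real n * F (n - 1) x)" for n x
  have "(G n has_field_derivative G (Suc n) x) (at x)" for n x
    \<comment> \<open>At \<open>n = 0\<close> the index \<open>n - 1\<close> truncates to 0, but its
      coefficient vanishes.\<close>
    by (cases n) (auto intro!: derivative_eq_intros assms simp: G_def[abs_def] algebra_simps)
  from higher_deriv_eqI[of G, OF this, of n] show ?thesis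
    by (simp add: G_def[abs_def])
qed

text \<open>The Leibniz sum stops after three terms because the third derivative of a quadratic is
  zero.\<close>

lemma higher_deriv_mult_quadratic:
  fixes F :: "nat \<Rightarrow> real \<Rightarrow> real"
  assumes "\<And>n x. (F n has_field_derivative F (Suc n) x) (at x)"
  shows "(deriv ^^ n) (\<lambda>x. (x\<^sup>2 + c) * F 0 x) =
    (\<lambda>x. (x\<^sup>2 + c) * F n x + 2 * real n * x * F (n - 1) x + real n * (real n - 1) * F (n - 2) x)"
proof -
  define G where "G n x = (x\<^sup>2 + c) * F n x + 2 * real n * x * F (n - 1) x
    + real n * (real n - 1) * F (n - 2) x" for n x
  have "(G n has_field_derivative G (Suc n) x) (at x)" for n x
  proof -
    \<comment> \<open>For \<open>n < 2\<close> the truncated index \<open>n - 2\<close> again meets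
      a zero coefficient.\<close>
    consider "n = 0" | "n = 1" | m where "n = Suc (Suc m)"
      by (metis One_nat_def not0_implies_Suc)
    then show ?thesis
      by cases (auto intro!: derivative_eq_intros assms
          simp: G_def[abs_def] algebra_simps power2_eq_square)
  qed
  from higher_deriv_eqI[of G, OF this, of n] show ?thesis
    by (simp add: G_def[abs_def])
qed

definition quad_powr_deriv :: "real \<Rightarrow> nat \<Rightarrow> real \<Rightarrow> real" where
  "quad_powr_deriv a n = (deriv ^^ n) (\<lambda>t. (t\<^sup>2 + 4) powr a)"

text \<open>The polynomial factor left when \<open>(t\<^sup>2 + 4) powr (a - real n)\<close> is
  split off the \<open>n\<close>-th derivative of \<open>(t\<^sup>2 + 4) powr a\<close>.\<close>

fun quad_powr_numer :: "real \<Rightarrow> nat \<Rightarrow> real poly" where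
  "quad_powr_numer a 0 = 1"
| "quad_powr_numer a (Suc n) = [:4, 0, 1:] * pderiv (quad_powr_numer a n)
     + [:0, 2 * (a - real n):] * quad_powr_numer a n"

lemma quad_pos: "(x::real)\<^sup>2 + 4 > 0"
  by (simp add: add_nonneg_pos)

lemma powr_mult_self_pred: "(x::real) > 0 \<Longrightarrow> x * x powr (a - 1) = x powr a"
  by (simp add: powr_diff)

lemma has_field_derivative_quad_powr:
  "((\<lambda>t::real. (t\<^sup>2 + 4) powr a) has_field_derivative 2 * a * x * (x\<^sup>2 + 4) powr (a - 1)) (at x)"
  using quad_pos[of x] by (auto intro!: derivative_eq_intros)

text \<open>As \<open>deriv\<close> is total, differentiability at every order needs proof; the
  explicit form, polynomial times power, supplies it.\<close>

lemma has_field_derivative_quad_powr_deriv: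
  "(quad_powr_deriv a n has_field_derivative quad_powr_deriv a (Suc n) x) (at x)"
proof -
  define F where "F n x = poly (quad_powr_numer a n) x * (x\<^sup>2 + 4) powr (a - real n)" for n x
  have F: "(F n has_field_derivative F (Suc n) x) (at x)" for n x
  proof -
    have w: "(x\<^sup>2 + 4) powr (a - real n) = (x\<^sup>2 + 4) * (x\<^sup>2 + 4) powr (a - real n - 1)"
      using powr_mult_self_pred[OF quad_pos] by simp
    have "(F n has_field_derivative
        poly (pderiv (quad_powr_numer a n)) x * (x\<^sup>2 + 4) powr (a - real n) +
        2 * (a - real n) * x * (x\<^sup>2 + 4) powr (a - real n - 1) * poly (quad_powr_numer a n) x) (at x)"
      unfolding F_def[abs_def]
      by (rule DERIV_mult[OF poly_DERIV has_field_derivative_quad_powr])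
    moreover have "poly (pderiv (quad_powr_numer a n)) x * (x\<^sup>2 + 4) powr (a - real n) +
        2 * (a - real n) * x * (x\<^sup>2 + 4) powr (a - real n - 1) * poly (quad_powr_numer a n) x = F (Suc n) x"
      unfolding w by (simp add: F_def algebra_simps power2_eq_square)
    ultimately show ?thesis by simp
  qed
  have "F 0 = (\<lambda>t. (t\<^sup>2 + 4) powr a)"
    by (simp add: F_def[abs_def])
  then have "quad_powr_deriv a n = F n" for n
    using higher_deriv_eqI[of F, OF F] by (simp add: quad_powr_deriv_def)
  with F show ?thesis by simp
qed

lemma quad_powr_deriv_0: "quad_powr_deriv a 0 = (\<lambda>t. (t\<^sup>2 + 4) powr a)"
  by (simp add: quad_powr_deriv_def)

lemma quad_powr_deriv_Suc:
  "quad_powr_deriv a (Suc n) x =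
    2 * a * (x * quad_powr_deriv (a - 1) n x + real n * quad_powr_deriv (a - 1) (n - 1) x)"
proof -
  let ?F = "quad_powr_deriv (a - 1)"
  have "deriv (\<lambda>t. (t\<^sup>2 + 4) powr a) = (\<lambda>t. 2 * a * (t * ?F 0 t))"
    using DERIV_imp_deriv[OF has_field_derivative_quad_powr]
    by (auto simp: quad_powr_deriv_0 mult.assoc)
  then have "quad_powr_deriv a (Suc n) = (deriv ^^ n) (\<lambda>t. 2 * a * (t * ?F 0 t))"
    by (simp only: quad_powr_deriv_def funpow_Suc_right o_apply)
  also have "\<dots> = (\<lambda>t. 2 * a * (t * ?F n t + real n * ?F (n - 1) t))"
    by (rule higher_deriv_mult_linear) (rule has_field_derivative_quad_powr_deriv)
  finally show ?thesis by simp
qed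

lemma quad_powr_deriv_mult_quad:
  "quad_powr_deriv a n x = (x\<^sup>2 + 4) * quad_powr_deriv (a - 1) n x
    + 2 * real n * x * quad_powr_deriv (a - 1) (n - 1) x
    + real n * (real n - 1) * quad_powr_deriv (a - 1) (n - 2) x"
proof -
  have "(\<lambda>t::real. (t\<^sup>2 + 4) powr a) = (\<lambda>t. (t\<^sup>2 + 4) * quad_powr_deriv (a - 1) 0 t)"
    using powr_mult_self_pred[OF quad_pos] by (simp add: quad_powr_deriv_0)
  then show ?thesis
    using higher_deriv_mult_quadratic[of "quad_powr_deriv (a - 1)" n 4,
        OF has_field_derivative_quad_powr_deriv]
    by (simp only: quad_powr_deriv_def[of a])
qed

lemma quad_powr_deriv_diag_Suc:
  "real (Suc s) * quad_powr_deriv (real s + 1 / 2) s x =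
    (2 * real s + 1) * ((x\<^sup>2 + 4) * quad_powr_deriv (real s - 1 / 2) s x
      + real s * x * quad_powr_deriv (real s - 1 / 2) (s - 1) x)"
proof (cases s)
  case 0
  then show ?thesis
    using quad_powr_deriv_mult_quad[of "1/2" 0 x] by simp
next
  case (Suc m)
  define f g h k where "f = quad_powr_deriv (real s - 1 / 2) s x"
    and "g = quad_powr_deriv (real s - 1 / 2) m x"
    and "h = quad_powr_deriv (real s - 1 / 2) (m - 1) x"
    and "k = quad_powr_deriv (real s + 1 / 2) s x"
  have 1: "k = (2 * real m + 3) * (x * g + real m * h)"
    using quad_powr_deriv_Suc[of "real s + 1 / 2" m x]
    by (simp add: Suc f_def g_def h_def k_def algebra_simps)
  have 2: "k = (x\<^sup>2 + 4) * f + 2 * (real m + 1) * x * g + (real m + 1) * real m * h"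
    using quad_powr_deriv_mult_quad[of "real s + 1 / 2" s x]
    by (simp add: Suc f_def g_def h_def k_def algebra_simps)
  \<comment> \<open>\<open>2 * real m + 3\<close> times the second relation minus
    \<open>real m + 1\<close> times the first cancels \<open>h\<close>.\<close>
  have "(real m + 2) * k = (2 * real m + 3) * ((x\<^sup>2 + 4) * f + (real m + 1) * x * g)"
    using 1 2 by algebra
  then show ?thesis
    by (simp add: Suc f_def g_def h_def k_def algebra_simps)
qed

lemma quad_powr_deriv_diag_rec:
  fixes s :: nat and x :: real
  defines "f \<equiv> \<lambda>s. quad_powr_deriv (real s - 1 / 2) s x"
  shows "f (Suc (Suc s)) = 2 * (2 * real s + 3) * (x * f (Suc s) + 2 * (2 * real s + 1) * f s)"
proof -
  \<comment> \<open>With the weight \<open>real s\<close>, the pair \<open>f\<close>,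
    \<open>g\<close> satisfies a closed first-order linear system.\<close>
  define g where "g s = real s * quad_powr_deriv (real s - 1 / 2) (s - 1) x" for s
  have f: "f (Suc s) = (2 * real s + 1) * (x * f s + g s)" for s
    using quad_powr_deriv_Suc[of "real s + 1 / 2" s x]
    by (simp add: f_def g_def algebra_simps)
  have g: "g (Suc s) = (2 * real s + 1) * ((x\<^sup>2 + 4) * f s + x * g s)"
    using quad_powr_deriv_diag_Suc[of s x]
    by (simp add: f_def g_def algebra_simps)
  have "f (Suc (Suc s)) = (2 * real s + 3) * (x * f (Suc s) + g (Suc s))"
    using f[of "Suc s"] by (simp add: algebra_simps)
  \<comment> \<open>Eliminating \<open>g s\<close> leaves
    \<open>(x\<^sup>2 + 4) - x\<^sup>2 = 4\<close> as the source of the coefficient of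
    \<open>f s\<close>.\<close>
  with f[of s] g show ?thesis by algebra
qed

lemma fact_ratio_Suc:
  "fact s / fact (2 * s) = 2 * (2 * real s + 1) * (fact (Suc s) / fact (2 * Suc s) :: real)"
proof -
  have "(fact (2 * Suc s) :: real) = 2 * (2 * real s + 1) * (real s + 1) * fact (2 * s)"
    by (simp add: algebra_simps)
  moreover have "2 * real s + 1 \<noteq> 0" "real s + 1 \<noteq> 0" by linarith+
  ultimately show ?thesis by (simp add: divide_simps)
qed

theorem theorem2p1:
  fixes s :: nat and \<Theta> :: real
  shows "poly (lucas_poly s) \<Theta> =
    2 * (fact s / fact (2 * s)) * (\<Theta>\<^sup>2 + 4) powr (1 / 2) *
      (deriv ^^ s) (\<lambda>t :: real. (t\<^sup>2 + 4) powr (real s - 1 / 2)) \<Theta>"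
  unfolding quad_powr_deriv_def[symmetric]
proof (induction s rule: lucas_poly.induct)
  case 1
  have "(\<Theta>\<^sup>2 + 4) powr (1 / 2) * (\<Theta>\<^sup>2 + 4) powr (- (1 / 2)) = 1"
    using quad_pos[of \<Theta>] by (simp add: powr_add[symmetric])
  then show ?case by (simp add: quad_powr_deriv_0)
next
  case 2
  have "(\<Theta>\<^sup>2 + 4) powr (1 / 2) * (\<Theta>\<^sup>2 + 4) powr (- (1 / 2)) = 1"
    using quad_pos[of \<Theta>] by (simp add: powr_add[symmetric])
  then show ?case
    using quad_powr_deriv_Suc[of "1 / 2" 0 \<Theta>]
    by (simp add: quad_powr_deriv_0 fact_numeral)
next
  case (3 s)
  define c :: "nat \<Rightarrow> real" where "c s = fact s / fact (2 * s)" for s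
  define f where "f s = quad_powr_deriv (real s - 1 / 2) s \<Theta>" for s
  define r where "r = (\<Theta>\<^sup>2 + 4) powr (1 / 2)"
  \<comment> \<open>These factors are exactly those in the recurrence of \<open>f\<close>, so
    everything becomes a multiple of \<open>c (Suc (Suc s))\<close>.\<close>
  have c: "c s = 2 * (2 * real s + 1) * c (Suc s)"
    "c (Suc s) = 2 * (2 * real s + 3) * c (Suc (Suc s))"
    using fact_ratio_Suc[of s] fact_ratio_Suc[of "Suc s"] unfolding c_def
    by (simp_all only: of_nat_Suc distrib_left) simp_all
  have f: "f (Suc (Suc s)) = 2 * (2 * real s + 3) * (\<Theta> * f (Suc s) + 2 * (2 * real s + 1) * f s)"
    unfolding f_def by (rule quad_powr_deriv_diag_rec)
  have IH: "poly (lucas_poly s) \<Theta> = 2 * c s * r * f s"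
    "poly (lucas_poly (Suc s)) \<Theta> = 2 * c (Suc s) * r * f (Suc s)"
    using 3 unfolding c_def f_def r_def by auto
  have "poly (lucas_poly (Suc (Suc s))) \<Theta> = \<Theta> * (2 * c (Suc s) * r * f (Suc s)) + 2 * c s * r * f s"
    using IH by simp
  also have "\<dots> = 2 * c (Suc (Suc s)) * r * f (Suc (Suc s))"
    unfolding f c by algebra
  finally show ?case unfolding c_def f_def r_def .
qed

end
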